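(* Let $\bar q=(\bar q_1,\dots,\bar q_B)$ be a probability vector, let $\bar n>0$, let $v_b(\theta)\ge 0$ for $b=1,\dots,B$ (with $\theta$ fixed), and consider the problem $$\min_{\mathbf n\in\mathbb{R}_+^B}\;\sum_{b=1}^B \bar q_b\,\frac{v_b(\theta)}{n_b}\qquad\text{s.t.}\qquad\sum_{b=1}^B \bar q_b\,n_b=\bar n. \tag{P}$$ Let $A=\{b\in\{1,\dots,B\}:\bar q_b>0\}$. If $v_b(\theta)>0$ for all $b\in A$, then the minimizer of (P) is unique on the coordinates in $A$ and is given by $$n_b^\star=\bar n\cdot\frac{\sqrt{v_b(\theta)}}{\sum_{j=1}^B \bar q_j\sqrt{v_j(\theta)}},\qquad b\in A.$$ For $b\notin A$, the variable $n_b$ affects neither the objective nor the constraint and may be chosen arbitrarily. Moreover, the minimal objective value is $$\sum_{b=1}^B \bar q_b\,\frac{v_b(\theta)}{n_b^\star}=\frac{\left(\sum_{b=1}^B \bar q_b\sqrt{v_b(\theta)}\right)^2}{\bar n}.$$ Compared to the uniform allocation $n_b\equiv\bar n$, $$\sum_{b=1}^B \bar q_b\,\frac{v_b(\theta)}{n_b^\star}\;\le\;\sum_{b=1}^B \bar q_b\,\frac{v_b(\theta)}{\bar n}=\frac{\sum_{b=1}^B \bar q_b v_b(\theta)}{\bar n},$$ with equality if and only if $v_b(\theta)$ is constant across $b\in A$.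
   Context: Here $\mathbb{R}_+^B$ denotes vectors with positive real coordinates. The numbers $\bar q_b$ are the empirical fractions of prompts in bin $b$ in a batch (so they are nonnegative and sum to $1$), $n_b$ is the (continuously relaxed) number of rollouts per prompt in bin $b$, $\bar n$ is the mean rollout budget, and $v_b(\theta)$ is a variance constant of bin $b$; for fixed $\theta$ all of $\bar q_b,\bar n,v_b(\theta)$ are constants. *)

theory Defs
  imports "HOL-Analysis.Analysis"
begin

text \<open>
  The bins are the elements of a finite index type \<open>'b\<close>, so that
  \<open>B = CARD('b)\<close>. In \<open>rollout_objective\<close> and \<open>opt_rollouts\<close> the argument \<open>v\<close>
  is the vector of variance constants at one fixed parameter value.
\<close>

definition positive_vectors :: "(real ^ 'b::finite) set" where
  "positive_vectors = {n. \<forall>b. 0 < n $ b}"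

definition probability_vector :: "real ^ 'b::finite \<Rightarrow> bool" where
  "probability_vector q \<longleftrightarrow> (\<forall>b. 0 \<le> q $ b) \<and> (\<Sum>b\<in>UNIV. q $ b) = 1"

definition active_bins :: "real ^ 'b::finite \<Rightarrow> 'b set" where
  "active_bins q = {b. 0 < q $ b}"

definition rollout_objective :: "real ^ 'b::finite \<Rightarrow> real ^ 'b \<Rightarrow> real ^ 'b \<Rightarrow> real" where
  "rollout_objective q v n = (\<Sum>b\<in>UNIV. q $ b * (v $ b / n $ b))"

definition mean_rollouts :: "real ^ 'b::finite \<Rightarrow> real ^ 'b \<Rightarrow> real" where
  "mean_rollouts q n = (\<Sum>b\<in>UNIV. q $ b * n $ b)"

definition feasible_allocations :: "real ^ 'b::finite \<Rightarrow> real \<Rightarrow> (real ^ 'b) set" where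
  "feasible_allocations q nbar = {n \<in> positive_vectors. mean_rollouts q n = nbar}"

definition is_minimizer :: "real ^ 'b::finite \<Rightarrow> real ^ 'b \<Rightarrow> real \<Rightarrow> real ^ 'b \<Rightarrow> bool" where
  "is_minimizer q v nbar n \<longleftrightarrow>
     is_arg_min (rollout_objective q v) (\<lambda>m. m \<in> feasible_allocations q nbar) n"

text \<open>
  Only the values at active bins matter: at an inactive bin with \<open>v $ b = 0\<close> this is \<open>0\<close>,
  which is not an admissible coordinate.
\<close>

definition opt_rollouts :: "real ^ 'b::finite \<Rightarrow> real ^ 'b \<Rightarrow> real \<Rightarrow> 'b \<Rightarrow> real" where
  "opt_rollouts q v nbar b = nbar * (sqrt (v $ b) / (\<Sum>j\<in>UNIV. q $ j * sqrt (v $ j)))"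

end

theory Submission
  imports Defs
begin

text \<open>
  Write \<open>S = (\<Sum>b. q\<^sub>b * sqrt v\<^sub>b)\<close>. On the constraint set, completing the square gives
  \<open>(\<Sum>b. q\<^sub>b * v\<^sub>b / n\<^sub>b) - S\<^sup>2 / nbar = (\<Sum>b. q\<^sub>b * n\<^sub>b * (sqrt v\<^sub>b / n\<^sub>b - S / nbar)\<^sup>2)\<close>,
  which is nonnegative and vanishes exactly when \<open>n\<^sub>b = nbar * sqrt v\<^sub>b / S\<close> at every active bin.
  The comparison with the uniform allocation is the same identity at \<open>n\<^sub>b = nbar\<close>.
\<close>

section \<open>Reduction to the active bins\<close>

lemma probability_vector_nonneg: "probability_vector q \<Longrightarrow> 0 \<le> q $ b"
  by (simp add: probability_vector_def)

lemma probability_vector_sum: "probability_vector q \<Longrightarrow> (\<Sum>b\<in>UNIV. q $ b) = 1"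
  by (simp add: probability_vector_def)

lemma inactive_bin_eq_0: "probability_vector q \<Longrightarrow> b \<notin> active_bins q \<Longrightarrow> q $ b = 0"
  using probability_vector_nonneg[of q b] by (simp add: active_bins_def)

text \<open>The weight \<open>q $ b\<close> is 0 at every inactive bin, so values there cannot
  matter. Used for the objective, for the constraint and for sums of the form of
  \<open>S\<close>.\<close>

lemma weighted_sum_cong_active:
  assumes "probability_vector q" and "\<And>b. b \<in> active_bins q \<Longrightarrow> f b = g b"
  shows "(\<Sum>b\<in>UNIV. q $ b * f b) = (\<Sum>b\<in>UNIV. q $ b * g b)"
proof (rule sum.cong)
  show "q $ b * f b = q $ b * g b" for b
    using assms inactive_bin_eq_0 by (cases "b \<in> active_bins q") auto
qed simp

lemma rollout_objective_cong_active:
  assumes "probability_vector q" and "\<And>b. b \<in> active_bins q \<Longrightarrow> m $ b = n $ b"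
  shows "rollout_objective q v m = rollout_objective q v n"
  unfolding rollout_objective_def by (rule weighted_sum_cong_active) (use assms in auto)

lemma mean_rollouts_cong_active:
  assumes "probability_vector q" and "\<And>b. b \<in> active_bins q \<Longrightarrow> m $ b = n $ b"
  shows "mean_rollouts q m = mean_rollouts q n"
  unfolding mean_rollouts_def by (rule weighted_sum_cong_active) (use assms in auto)

text \<open>Since the weights sum to 1, some bin is active; its term is positive, and every other
  term is positive or has weight 0. This makes \<open>S\<close> a legitimate denominator in
  \<open>opt_rollouts\<close>.\<close>

lemma sum_sqrt_pos:
  assumes q: "probability_vector q" and v: "\<And>b. b \<in> active_bins q \<Longrightarrow> 0 < v $ b"
  shows "0 < (\<Sum>b\<in>UNIV. q $ b * sqrt (v $ b))"
proof -
  obtain a where a: "a \<in> active_bins q"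
    using probability_vector_sum[OF q] inactive_bin_eq_0[OF q]
    by (metis sum.neutral zero_neq_one)
  have "0 \<le> q $ b * sqrt (v $ b)" for b
    using v[of b] inactive_bin_eq_0[OF q, of b] probability_vector_nonneg[OF q, of b]
    by (cases "b \<in> active_bins q") auto
  moreover have "0 < q $ a * sqrt (v $ a)"
    using a v[OF a] by (simp add: active_bins_def)
  ultimately show ?thesis
    by (intro sum_pos2[where i = a]) auto
qed

section \<open>The excess over the lower bound, and the equality case\<close>

lemma rollout_objective_excess:
  fixes q v n :: "real ^ 'b::finite"
  defines "S \<equiv> \<Sum>b\<in>UNIV. q $ b * sqrt (v $ b)"
  assumes v: "\<And>b. 0 \<le> v $ b" and nbar: "0 < nbar"
    and n: "n \<in> feasible_allocations q nbar"
  shows "rollout_objective q v n - S\<^sup>2 / nbar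
    = (\<Sum>b\<in>UNIV. q $ b * n $ b * (sqrt (v $ b) / n $ b - S / nbar)\<^sup>2)"
proof -
  have pos: "0 < n $ b" for b
    using n by (simp add: feasible_allocations_def positive_vectors_def)
  have mean: "(\<Sum>b\<in>UNIV. q $ b * n $ b) = nbar"
    using n by (simp add: feasible_allocations_def mean_rollouts_def)
  have "q $ b * n $ b * (sqrt (v $ b) / n $ b - S / nbar)\<^sup>2
      = q $ b * (v $ b / n $ b) - 2 * S / nbar * (q $ b * sqrt (v $ b))
        + (S / nbar)\<^sup>2 * (q $ b * n $ b)" for b
  proof -
    \<comment> \<open>The weight is left out at first: the square is expanded and
      \<open>n $ b\<close> cancelled, and only then is everything multiplied by
      \<open>q $ b\<close>. Nonnegativity of \<open>v $ b\<close> turns the squared root back into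
      \<open>v $ b\<close>.\<close>
    have "n $ b * (sqrt (v $ b) / n $ b - S / nbar)\<^sup>2
        = (sqrt (v $ b))\<^sup>2 / n $ b - 2 * S / nbar * sqrt (v $ b) + (S / nbar)\<^sup>2 * n $ b"
      using pos[of b] nbar by (simp add: power2_eq_square field_simps)
    from arg_cong[OF this, of "\<lambda>x. q $ b * x"] show ?thesis
      using v[of b] by (simp add: distrib_left right_diff_distrib ac_simps)
  qed
  \<comment> \<open>Summed over the bins, the cross term yields another factor \<open>S\<close>, and
    the constraint turns the last sum into \<open>nbar\<close>. Together they leave -2
    \<open>S\<^sup>2\<close> / \<open>nbar\<close> + \<open>S\<^sup>2\<close> /
    \<open>nbar\<close>.\<close>
  then have "(\<Sum>b\<in>UNIV. q $ b * n $ b * (sqrt (v $ b) / n $ b - S / nbar)\<^sup>2)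
      = rollout_objective q v n - 2 * S / nbar * S + (S / nbar)\<^sup>2 * nbar"
    by (simp only: sum.distrib sum_subtractf rollout_objective_def S_def mean
        flip: sum_distrib_left)
  also have "\<dots> = rollout_objective q v n - S\<^sup>2 / nbar"
    using nbar by (simp add: power2_eq_square field_simps)
  finally show ?thesis by simp
qed

text \<open>In effect the Cauchy-Schwarz inequality for the vectors with entries sqrt(q_b v_b / n_b)
  and sqrt(q_b n_b), read off from the sign of the excess.\<close>

lemma rollout_objective_ge:
  assumes q: "probability_vector q" and v: "\<And>b. 0 \<le> v $ b" and nbar: "0 < nbar"
    and n: "n \<in> feasible_allocations q nbar"
  shows "(\<Sum>b\<in>UNIV. q $ b * sqrt (v $ b))\<^sup>2 / nbar \<le> rollout_objective q v n"
proof -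
  have "0 \<le> n $ b" for b
    using n by (simp add: feasible_allocations_def positive_vectors_def less_imp_le)
  then have "0 \<le> (\<Sum>b\<in>UNIV. q $ b * n $ b
      * (sqrt (v $ b) / n $ b - (\<Sum>b\<in>UNIV. q $ b * sqrt (v $ b)) / nbar)\<^sup>2)"
    by (intro sum_nonneg mult_nonneg_nonneg) (simp_all add: probability_vector_nonneg[OF q])
  then show ?thesis
    using rollout_objective_excess[OF v nbar n] by linarith
qed

text \<open>A sum of nonnegative terms vanishes only if each term does, and
  \<open>q $ b * n $ b\<close> is nonzero exactly at active bins. It is applied both to the
  minimizers and to the uniform allocation.\<close>

lemma rollout_objective_eq_bound_iff:
  assumes q: "probability_vector q" and v: "\<And>b. 0 \<le> v $ b" and nbar: "0 < nbar"
    and n: "n \<in> feasible_allocations q nbar"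
    and act: "\<And>b. b \<in> active_bins q \<Longrightarrow> 0 < v $ b"
  shows "rollout_objective q v n = (\<Sum>b\<in>UNIV. q $ b * sqrt (v $ b))\<^sup>2 / nbar
    \<longleftrightarrow> (\<forall>b\<in>active_bins q. n $ b = opt_rollouts q v nbar b)"
proof -
  define S where "S = (\<Sum>b\<in>UNIV. q $ b * sqrt (v $ b))"
  have S: "0 < S"
    unfolding S_def by (rule sum_sqrt_pos[OF q act])
  have pos: "0 < n $ b" for b
    using n by (simp add: feasible_allocations_def positive_vectors_def)
  have "rollout_objective q v n = S\<^sup>2 / nbar
    \<longleftrightarrow> (\<Sum>b\<in>UNIV. q $ b * n $ b * (sqrt (v $ b) / n $ b - S / nbar)\<^sup>2) = 0"
    using rollout_objective_excess[OF v nbar n] unfolding S_def by linarith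
  also have "\<dots> \<longleftrightarrow> (\<forall>b. q $ b * n $ b * (sqrt (v $ b) / n $ b - S / nbar)\<^sup>2 = 0)"
    by (subst sum_nonneg_eq_0_iff)
      (use pos in \<open>auto intro!: mult_nonneg_nonneg simp: less_imp_le probability_vector_nonneg[OF q]\<close>)
  also have "\<dots> \<longleftrightarrow> (\<forall>b\<in>active_bins q. sqrt (v $ b) / n $ b = S / nbar)"
  proof -
    have "q $ b * n $ b * (sqrt (v $ b) / n $ b - S / nbar)\<^sup>2 = 0
      \<longleftrightarrow> (b \<in> active_bins q \<longrightarrow> sqrt (v $ b) / n $ b = S / nbar)" for b
      using pos[of b] inactive_bin_eq_0[OF q, of b]
      by (cases "b \<in> active_bins q") (auto simp: active_bins_def)
    then show ?thesis by blast
  qed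
  also have "\<dots> \<longleftrightarrow> (\<forall>b\<in>active_bins q. n $ b = nbar * (sqrt (v $ b) / S))"
  proof (intro ball_cong refl)
    show "sqrt (v $ b) / n $ b = S / nbar \<longleftrightarrow> n $ b = nbar * (sqrt (v $ b) / S)" for b
      using pos[of b] nbar S by (auto simp: field_simps)
  qed
  finally show ?thesis
    by (simp add: S_def opt_rollouts_def)
qed

section \<open>Attainment of the bound and description of the minimizers\<close>

lemma opt_rollouts_feasible:
  assumes q: "probability_vector q" and n: "n \<in> positive_vectors"
    and act: "\<And>b. b \<in> active_bins q \<Longrightarrow> 0 < v $ b"
    and opt: "\<And>b. b \<in> active_bins q \<Longrightarrow> n $ b = opt_rollouts q v nbar b"
  shows "n \<in> feasible_allocations q nbar"
proof -
  define S where "S = (\<Sum>b\<in>UNIV. q $ b * sqrt (v $ b))"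
  have S: "0 < S"
    unfolding S_def by (rule sum_sqrt_pos[OF q act])
  \<comment> \<open>The formula is known at active bins only, but may be substituted in every term
    because the other weights vanish. Pulling out \<open>nbar / S\<close> then leaves
    \<open>S\<close>.\<close>
  have "mean_rollouts q n = (\<Sum>b\<in>UNIV. q $ b * (nbar * (sqrt (v $ b) / S)))"
    unfolding mean_rollouts_def
    by (rule weighted_sum_cong_active[OF q]) (simp add: opt opt_rollouts_def S_def)
  also have "\<dots> = (\<Sum>b\<in>UNIV. nbar / S * (q $ b * sqrt (v $ b)))"
    by (simp add: field_simps)
  also have "\<dots> = nbar / S * S"
    unfolding S_def by (rule sum_distrib_left [symmetric])
  also have "\<dots> = nbar"
    using S by simp
  finally show ?thesis
    using n by (simp add: feasible_allocations_def)
qed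

lemma exists_opt_allocation:
  assumes q: "probability_vector q" and nbar: "0 < nbar"
    and act: "\<And>b. b \<in> active_bins q \<Longrightarrow> 0 < v $ b"
  shows "\<exists>n\<in>positive_vectors. \<forall>b\<in>active_bins q. n $ b = opt_rollouts q v nbar b"
proof
  \<comment> \<open>The value 1 is an arbitrary positive choice; at an inactive bin
    \<open>opt_rollouts\<close> could be 0.\<close>
  let ?n = "\<chi> b. if b \<in> active_bins q then opt_rollouts q v nbar b else 1"
  show "\<forall>b\<in>active_bins q. ?n $ b = opt_rollouts q v nbar b"
    by simp
  show "?n \<in> positive_vectors"
    using sum_sqrt_pos[OF q act] nbar act by (simp add: positive_vectors_def opt_rollouts_def)
qed

text \<open>The bound is attained at a feasible \<open>m\<close>, so it is the minimum. A minimizer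
  is squeezed between the bound from below and the value at \<open>m\<close> from above.\<close>

lemma is_minimizer_iff_bound:
  assumes q: "probability_vector q" and v: "\<And>b. 0 \<le> v $ b" and nbar: "0 < nbar"
    and act: "\<And>b. b \<in> active_bins q \<Longrightarrow> 0 < v $ b"
  shows "is_minimizer q v nbar n \<longleftrightarrow> n \<in> feasible_allocations q nbar
    \<and> rollout_objective q v n = (\<Sum>b\<in>UNIV. q $ b * sqrt (v $ b))\<^sup>2 / nbar"
proof -
  obtain m where "m \<in> positive_vectors"
    and opt: "\<And>b. b \<in> active_bins q \<Longrightarrow> m $ b = opt_rollouts q v nbar b"
    using exists_opt_allocation[OF q nbar act] by blast
  then have m: "m \<in> feasible_allocations q nbar"
    using opt_rollouts_feasible[OF q _ act opt] by blast
  moreover have "rollout_objective q v m = (\<Sum>b\<in>UNIV. q $ b * sqrt (v $ b))\<^sup>2 / nbar"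
    using rollout_objective_eq_bound_iff[OF q v nbar m act] opt by blast
  moreover have "(\<Sum>b\<in>UNIV. q $ b * sqrt (v $ b))\<^sup>2 / nbar \<le> rollout_objective q v k"
    if "k \<in> feasible_allocations q nbar" for k
    by (rule rollout_objective_ge[OF q v nbar that])
  ultimately show ?thesis
    unfolding is_minimizer_def is_arg_min_linorder by (auto intro!: antisym[of "rollout_objective q v n"])
qed

text \<open>The right-hand side does not mention the constraint: it follows from the formula by
  \<open>opt_rollouts_feasible\<close>.\<close>

lemma is_minimizer_iff_opt_rollouts:
  assumes q: "probability_vector q" and v: "\<And>b. 0 \<le> v $ b" and nbar: "0 < nbar"
    and act: "\<And>b. b \<in> active_bins q \<Longrightarrow> 0 < v $ b"
  shows "is_minimizer q v nbar n \<longleftrightarrow> n \<in> positive_vectors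
    \<and> (\<forall>b\<in>active_bins q. n $ b = opt_rollouts q v nbar b)"
proof -
  have "n \<in> positive_vectors" if "n \<in> feasible_allocations q nbar"
    using that by (simp add: feasible_allocations_def)
  then show ?thesis
    using is_minimizer_iff_bound[OF q v nbar act] rollout_objective_eq_bound_iff[OF q v nbar _ act]
      opt_rollouts_feasible[OF q _ act] by blast
qed

section \<open>Comparison with the uniform allocation\<close>

lemma uniform_allocation_feasible:
  assumes "probability_vector q" and "0 < nbar"
  shows "(\<chi> b. nbar) \<in> feasible_allocations q nbar"
  using assms probability_vector_sum[OF assms(1)]
  by (simp add: feasible_allocations_def positive_vectors_def mean_rollouts_def
      flip: sum_distrib_right)

lemma rollout_objective_uniform:
  "rollout_objective q v (\<chi> b. nbar) = (\<Sum>b\<in>UNIV. q $ b * v $ b) / nbar"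
  by (simp add: rollout_objective_def sum_divide_distrib)

text \<open>The left side says that \<open>sqrt (v $ b)\<close> equals the weighted mean
  \<open>S\<close> at every active bin. Values that all equal their mean are constant, and a
  constant is its own mean because the weights sum to 1.\<close>

lemma uniform_opt_rollouts_iff:
  assumes q: "probability_vector q" and nbar: "0 < nbar"
    and act: "\<And>b. b \<in> active_bins q \<Longrightarrow> 0 < v $ b"
  shows "(\<forall>b\<in>active_bins q. nbar = opt_rollouts q v nbar b)
    \<longleftrightarrow> (\<lambda>b. v $ b) constant_on active_bins q"
proof -
  define S where "S = (\<Sum>b\<in>UNIV. q $ b * sqrt (v $ b))"
  have S: "0 < S"
    unfolding S_def by (rule sum_sqrt_pos[OF q act])
  have "nbar = opt_rollouts q v nbar b \<longleftrightarrow> sqrt (v $ b) = S" for b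
    using S nbar by (auto simp: opt_rollouts_def field_simps simp flip: S_def)
  moreover have "(\<forall>b\<in>active_bins q. sqrt (v $ b) = S) \<longleftrightarrow> (\<lambda>b. v $ b) constant_on active_bins q"
  proof
    assume "\<forall>b\<in>active_bins q. sqrt (v $ b) = S"
    then have "\<forall>b\<in>active_bins q. v $ b = S\<^sup>2"
      using act by (metis less_imp_le real_sqrt_pow2)
    then show "(\<lambda>b. v $ b) constant_on active_bins q"
      by (auto simp: constant_on_def)
  next
    assume "(\<lambda>b. v $ b) constant_on active_bins q"
    then obtain c where c: "\<And>b. b \<in> active_bins q \<Longrightarrow> v $ b = c"
      by (auto simp: constant_on_def)
    then have "S = (\<Sum>b\<in>UNIV. q $ b * sqrt c)"
      unfolding S_def by (intro weighted_sum_cong_active[OF q]) simp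
    also have "\<dots> = sqrt c"
      using probability_vector_sum[OF q] by (simp flip: sum_distrib_right)
    finally show "\<forall>b\<in>active_bins q. sqrt (v $ b) = S"
      using c by simp
  qed
  ultimately show ?thesis by simp
qed

theorem theoremB17:
  fixes q :: "real ^ 'b::finite"
    and nbar :: real
    and v :: "'t \<Rightarrow> real ^ 'b"
    and \<theta> :: 't
  assumes q: "probability_vector q"
    and nbar: "0 < nbar"
    and v: "\<And>b. 0 \<le> v \<theta> $ b"
  shows "(\<forall>n\<in>positive_vectors. \<forall>m\<in>positive_vectors.
            (\<forall>b\<in>active_bins q. m $ b = n $ b) \<longrightarrow>
              rollout_objective q (v \<theta>) m = rollout_objective q (v \<theta>) n \<and>
              mean_rollouts q m = mean_rollouts q n)
       \<and> ((\<forall>b\<in>active_bins q. 0 < v \<theta> $ b) \<longrightarrow>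
            (\<exists>n. is_minimizer q (v \<theta>) nbar n) \<and>
            (\<forall>n. is_minimizer q (v \<theta>) nbar n \<longleftrightarrow>
                   n \<in> positive_vectors \<and>
                   (\<forall>b\<in>active_bins q. n $ b = opt_rollouts q (v \<theta>) nbar b)) \<and>
            (\<forall>n. is_minimizer q (v \<theta>) nbar n \<longrightarrow>
                   rollout_objective q (v \<theta>) n
                     = (\<Sum>b\<in>UNIV. q $ b * sqrt (v \<theta> $ b))\<^sup>2 / nbar \<and>
                   rollout_objective q (v \<theta>) n \<le> rollout_objective q (v \<theta>) (\<chi> b. nbar) \<and>
                   rollout_objective q (v \<theta>) (\<chi> b. nbar)
                     = (\<Sum>b\<in>UNIV. q $ b * v \<theta> $ b) / nbar \<and>
                   (rollout_objective q (v \<theta>) n = rollout_objective q (v \<theta>) (\<chi> b. nbar)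
                      \<longleftrightarrow> (\<lambda>b. v \<theta> $ b) constant_on active_bins q)))"
proof (intro conjI ballI impI)
  fix n m :: "real ^ 'b"
  assume "\<forall>b\<in>active_bins q. m $ b = n $ b"
  then show "rollout_objective q (v \<theta>) m = rollout_objective q (v \<theta>) n"
    and "mean_rollouts q m = mean_rollouts q n"
    by (blast intro: rollout_objective_cong_active[OF q] mean_rollouts_cong_active[OF q])+
next
  assume "\<forall>b\<in>active_bins q. 0 < v \<theta> $ b"
  then have act: "\<And>b. b \<in> active_bins q \<Longrightarrow> 0 < v \<theta> $ b" by blast
  note opt_iff = is_minimizer_iff_opt_rollouts[OF q v nbar act]
  note unif = uniform_allocation_feasible[OF q nbar]
  show "\<exists>n. is_minimizer q (v \<theta>) nbar n"
    using exists_opt_allocation[OF q nbar act] opt_iff by blast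
  show "\<forall>n. is_minimizer q (v \<theta>) nbar n \<longleftrightarrow> n \<in> positive_vectors \<and>
      (\<forall>b\<in>active_bins q. n $ b = opt_rollouts q (v \<theta>) nbar b)"
    using opt_iff by blast
  show "\<forall>n. is_minimizer q (v \<theta>) nbar n \<longrightarrow>
      rollout_objective q (v \<theta>) n = (\<Sum>b\<in>UNIV. q $ b * sqrt (v \<theta> $ b))\<^sup>2 / nbar \<and>
      rollout_objective q (v \<theta>) n \<le> rollout_objective q (v \<theta>) (\<chi> b. nbar) \<and>
      rollout_objective q (v \<theta>) (\<chi> b. nbar) = (\<Sum>b\<in>UNIV. q $ b * v \<theta> $ b) / nbar \<and>
      (rollout_objective q (v \<theta>) n = rollout_objective q (v \<theta>) (\<chi> b. nbar)
        \<longleftrightarrow> (\<lambda>b. v \<theta> $ b) constant_on active_bins q)"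
  proof (intro allI impI)
    fix n
    assume "is_minimizer q (v \<theta>) nbar n"
    then have val: "rollout_objective q (v \<theta>) n = (\<Sum>b\<in>UNIV. q $ b * sqrt (v \<theta> $ b))\<^sup>2 / nbar"
      using is_minimizer_iff_bound[OF q v nbar act] by blast
    \<comment> \<open>The general lower bound, taken at the uniform allocation, is the comparison
      itself once the minimal value is substituted.\<close>
    moreover have "rollout_objective q (v \<theta>) n \<le> rollout_objective q (v \<theta>) (\<chi> b. nbar)"
      unfolding val by (rule rollout_objective_ge[OF q v nbar unif])
    \<comment> \<open>Equality means that the uniform allocation attains the bound, that is,
      \<open>nbar\<close> is the optimal value at every active bin.\<close>
    moreover have "rollout_objective q (v \<theta>) n = rollout_objective q (v \<theta>) (\<chi> b. nbar)
        \<longleftrightarrow> (\<lambda>b. v \<theta> $ b) constant_on active_bins q"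
      using rollout_objective_eq_bound_iff[OF q v nbar unif act]
        uniform_opt_rollouts_iff[OF q nbar act] val by auto
    ultimately show "rollout_objective q (v \<theta>) n
          = (\<Sum>b\<in>UNIV. q $ b * sqrt (v \<theta> $ b))\<^sup>2 / nbar \<and>
        rollout_objective q (v \<theta>) n \<le> rollout_objective q (v \<theta>) (\<chi> b. nbar) \<and>
        rollout_objective q (v \<theta>) (\<chi> b. nbar) = (\<Sum>b\<in>UNIV. q $ b * v \<theta> $ b) / nbar \<and>
        (rollout_objective q (v \<theta>) n = rollout_objective q (v \<theta>) (\<chi> b. nbar)
          \<longleftrightarrow> (\<lambda>b. v \<theta> $ b) constant_on active_bins q)"
      using rollout_objective_uniform by blast
  qed
qed

end
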